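(* Let $d_1<d_2<\cdots$ be the elements of $D$ and $u_1<u_2<\cdots$ the elements of $U$ in increasing order. Then \[\{d_{k+2}-d_k:k\ge1\}=\{u_{k+2}-u_k:k\ge1\}=\{2,3,4,5,6,8,10\}.\]
   Context: $\phi=(1+\sqrt5)/2$. For positive integers $a_1,a_2$, the $(a_1,a_2)$-Fibonacci walk is $w_k=w_k(a_1,a_2)$ with $w_1=a_1$, $w_2=a_2$, $w_{k+2}=w_{k+1}+w_k$. Let $s(n;a_1,a_2)$ be the integer $s$ with $w_s(a_1,a_2)=n$ ($-\infty$ if none), and $s(n)=\max_{a_1,a_2\ge1}s(n;a_1,a_2)$. A pair $(a_1,a_2)$ is $n$-good if $a_1,a_2\ge1$ and $s(n;a_1,a_2)=s(n)$; its walk is then an $n$-slow Fibonacci walk. An integer $n\ge2$ is in $D$ (down-integer) if $w_{s(n)+1}=\lfloor\phi n\rfloor$ for some $n$-slow walk, and in $U$ (up-integer) if $w_{s(n)+1}=\lceil\phi n\rceil$ for some $n$-slow walk. *)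

theory Defs
  imports Complex_Main "HOL-Library.Infinite_Set"
begin

definition golden_ratio :: real where
  "golden_ratio = (1 + sqrt 5) / 2"

(* Walks are indexed from 1; the value at index 0 is a dummy that is never used. *)
fun fib_walk :: "nat \<Rightarrow> nat \<Rightarrow> nat \<Rightarrow> nat" where
  "fib_walk a b 0 = 0"
| "fib_walk a b (Suc 0) = a"
| "fib_walk a b (Suc (Suc 0)) = b"
| "fib_walk a b (Suc (Suc (Suc k))) = fib_walk a b (Suc (Suc k)) + fib_walk a b (Suc k)"

(* s(n; a, b), with None in the role of minus infinity. For a, b >= 1 the index is
   unique except when a = b = n, where n occurs at 1 and 2 and the larger is taken;
   this never matters for n >= 2, since the walk from (1, n - 1) has n at index 3. *)
definition walk_index :: "nat \<Rightarrow> nat \<Rightarrow> nat \<Rightarrow> nat option" where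
  "walk_index n a b =
     (if \<exists>k\<ge>1. fib_walk a b k = n
      then Some (GREATEST k. k \<ge> 1 \<and> fib_walk a b k = n)
      else None)"

(* s(n). For n >= 1 the set is nonempty and finite (see the two lemmas at the end),
   so Max is a genuine maximum. *)
definition max_walk_index :: "nat \<Rightarrow> nat" where
  "max_walk_index n = Max {s. \<exists>a\<ge>1. \<exists>b\<ge>1. walk_index n a b = Some s}"

definition good_pair :: "nat \<Rightarrow> nat \<Rightarrow> nat \<Rightarrow> bool" where
  "good_pair n a b \<longleftrightarrow> a \<ge> 1 \<and> b \<ge> 1 \<and> walk_index n a b = Some (max_walk_index n)"

definition down_integers :: "nat set" where
  "down_integers = {n. n \<ge> 2 \<and> (\<exists>a b. good_pair n a b \<and>
     int (fib_walk a b (max_walk_index n + 1)) = \<lfloor>golden_ratio * real n\<rfloor>)}"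

definition up_integers :: "nat set" where
  "up_integers = {n. n \<ge> 2 \<and> (\<exists>a b. good_pair n a b \<and>
     int (fib_walk a b (max_walk_index n + 1)) = \<lceil>golden_ratio * real n\<rceil>)}"

lemma fib_walk_ge:
  assumes "a \<ge> 1" "b \<ge> 1"
  shows "fib_walk a b (Suc k) \<ge> max 1 k"
  using assms
proof (induction a b "Suc k" arbitrary: k rule: fib_walk.induct)
  case (4 a b k)
  have "fib_walk a b (Suc (Suc k)) \<ge> max 1 (Suc k)" "fib_walk a b (Suc k) \<ge> max 1 k"
    using 4 by blast+
  then show ?case using 4(4) by auto
qed auto

lemma finite_walk_indices:
  "finite {s. \<exists>a\<ge>1. \<exists>b\<ge>1. walk_index n a b = Some s}"
proof -
  have "s \<le> Suc n" if ab: "a \<ge> 1" "b \<ge> 1" and s: "walk_index n a b = Some s" for a b s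
  proof -
    let ?P = "\<lambda>k. k \<ge> 1 \<and> fib_walk a b k = n"
    have bound: "k \<le> Suc n" if "?P k" for k
      using fib_walk_ge[OF ab, of "k - 1"] that by auto
    from s have "\<exists>k. ?P k" and seq: "s = (GREATEST k. ?P k)"
      by (auto simp: walk_index_def split: if_splits)
    then have "?P s"
      using bound GreatestI_ex_nat[of ?P "Suc n"] by blast
    then show ?thesis by (rule bound)
  qed
  then show ?thesis
    by (auto intro: finite_subset[of _ "{..Suc n}"])
qed

lemma walk_indices_nonempty:
  assumes "n \<ge> 1"
  shows "{s. \<exists>a\<ge>1. \<exists>b\<ge>1. walk_index n a b = Some s} \<noteq> {}"
proof -
  have "fib_walk n 1 1 = n" by simp
  then have "\<exists>s. walk_index n n 1 = Some s"
    unfolding walk_index_def by (metis order_refl)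
  then show ?thesis using assms by blast
qed

end

(* Running the recursion backwards from (n, m) alternates in sign around the golden ratio phi, so
   each n >= 2 has a unique representation n = F_i a + F_{i+1} b with 1 <= b <= a <= F_{i+1}; its
   slowest walk reaches n at index i + 2, and the parity of i decides between D and U. In terms of
   the distance x of phi n to the floor (to the ceiling), membership in D (in U) says
   x < n / (phi^i F_i) and x + n / (phi^{i+1} F_{i+1}) <= 1 for some i of the right parity, that is
   x lies below a threshold which varies slowly with n and always stays between phi^{-3} and
   1 - phi^{-3}. Adding 1, 2, 3, 5 to n rotates x by phi^{-1}, phi^{-3}, phi^{-4}, phi^{-5} up to
   sign, and comparing with the threshold shows that consecutive elements differ by 1, 2, 3 or 5
   and that a difference 2 is never next to a difference 5. *)

theory Submission
  imports Defs "HOL-Number_Theory.Fib"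
begin

section \<open>Canonical representations\<close>

lemma fib_walk_fib: "fib_walk a b (i + 2) = fib i * a + fib (i + 1) * b"
  by (induction i rule: fib.induct) (simp_all add: algebra_simps)

lemma fib_walk_shift:
  "fib_walk (fib_walk a b (Suc k)) (fib_walk a b (Suc (Suc k))) (Suc j) = fib_walk a b (Suc (k + j))"
  by (induction j rule: fib.induct) simp_all

lemma fib_walk_less_Suc:
  assumes "a \<ge> 1" "b \<ge> 1"
  shows "fib_walk a b (i + 2) < fib_walk a b (i + 3)"
  using fib_walk_ge[OF assms, of i] by (simp add: numeral_3_eq_3)

lemma fib_walk_less:
  assumes "a \<ge> 1" "b \<ge> 1" "i < j"
  shows "fib_walk a b (i + 2) < fib_walk a b (j + 2)"
  using \<open>i < j\<close>
proof (rule lift_Suc_mono_less[rotated])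
  show "fib_walk a b (k + 2) < fib_walk a b (Suc k + 2)" for k
    using fib_walk_less_Suc[OF assms(1,2), of k] by (simp add: numeral_3_eq_3)
qed

text \<open>From index 2 on the walk is strictly increasing, so an occurrence of \<open>n\<close> at
  \<open>i + 2\<close> is the last one, which is what \<open>GREATEST\<close> selects.\<close>

lemma walk_indexI:
  assumes "a \<ge> 1" "b \<ge> 1" "fib_walk a b (i + 2) = n"
  shows "walk_index n a b = Some (i + 2)"
proof -
  have "(GREATEST k. k \<ge> 1 \<and> fib_walk a b k = n) = i + 2"
  proof (rule Greatest_equality)
    fix k assume k: "k \<ge> 1 \<and> fib_walk a b k = n"
    show "k \<le> i + 2"
    proof (rule ccontr)
      assume "\<not> k \<le> i + 2"
      then have "i < k - 2" "k = (k - 2) + 2" by auto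
      then show False
        using fib_walk_less[OF assms(1,2), of i "k - 2"] k assms(3) by simp
    qed
  qed (use assms in auto)
  moreover have "\<exists>k\<ge>1. fib_walk a b k = n"
    using assms(3) by (intro exI[of _ "i + 2"]) auto
  ultimately show ?thesis unfolding walk_index_def by simp
qed

lemma walk_indexD:
  assumes "a \<ge> 1" "b \<ge> 1" "walk_index n a b = Some s"
  shows "s \<ge> 1" "fib_walk a b s = n"
proof -
  let ?P = "\<lambda>k. k \<ge> 1 \<and> fib_walk a b k = n"
  have bound: "k \<le> Suc n" if "?P k" for k
    using fib_walk_ge[OF assms(1,2), of "k - 1"] that by auto
  have "\<exists>k. ?P k" "s = (GREATEST k. ?P k)"
    using assms(3) by (auto simp: walk_index_def split: if_splits)
  then have "?P s"
    using bound GreatestI_ex_nat[of ?P "Suc n"] by blast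
  then show "s \<ge> 1" "fib_walk a b s = n" by auto
qed

text \<open>By \<open>fib_walk_fib\<close> the sum below is the entry with index \<open>i + 2\<close> of the walk from \<open>(a, b)\<close>.\<close>

definition slow_rep :: "nat \<Rightarrow> nat \<Rightarrow> nat \<Rightarrow> nat \<Rightarrow> bool" where
  "slow_rep n i a b \<longleftrightarrow>
     i \<ge> 1 \<and> 1 \<le> b \<and> b \<le> a \<and> a \<le> fib (i + 1) \<and> n = fib i * a + fib (i + 1) * b"

text \<open>Take \<open>i\<close> maximal and then \<open>a\<close> minimal. If \<open>a\<close>
  exceeded \<open>fib (i + 1)\<close>, moving \<open>fib (i + 1)\<close> from \<open>a\<close> into
  \<open>fib i\<close> extra units of \<open>b\<close> would give a smaller \<open>a\<close>. If
  \<open>b\<close> exceeded \<open>a\<close>, prepending the term \<open>b - a\<close> to the walk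
  would give a larger \<open>i\<close>.\<close>

lemma slow_rep_exists:
  assumes "n \<ge> 2"
  shows "\<exists>i a b. slow_rep n i a b"
proof -
  define P where "P = (\<lambda>i. i \<ge> 1 \<and> (\<exists>a\<ge>1. \<exists>b\<ge>1. n = fib i * a + fib (i + 1) * b))"
  have P1: "P 1"
    using assms unfolding P_def
    by (intro conjI exI[of _ "n - 1"] exI[of _ 1]) (auto simp: numeral_2_eq_2)
  have bound: "i \<le> n" if Pi: "P i" for i
  proof -
    from Pi obtain a b where "a \<ge> 1" "b \<ge> 1" "n = fib_walk a b (Suc (Suc i))"
      unfolding P_def using fib_walk_fib[of _ _ i] by auto
    then show ?thesis using fib_walk_ge[of a b "Suc i"] by simp
  qed
  define i where "i = (GREATEST i. P i)"
  have Pi: "P i" and max: "\<And>j. P j \<Longrightarrow> j \<le> i"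
    unfolding i_def using GreatestI_nat[of P 1 n] Greatest_le_nat[of P _ n] P1 bound by auto
  define Q where "Q = (\<lambda>a. a \<ge> 1 \<and> (\<exists>b\<ge>1. n = fib i * a + fib (i + 1) * b))"
  have "\<exists>a. Q a" using Pi unfolding P_def Q_def by auto
  define a where "a = (LEAST a. Q a)"
  have "Q a" and min: "\<And>a'. Q a' \<Longrightarrow> a \<le> a'"
    unfolding a_def using LeastI_ex[OF \<open>\<exists>a. Q a\<close>] Least_le[of Q] by auto
  then obtain b where ab: "a \<ge> 1" "b \<ge> 1" "n = fib i * a + fib (i + 1) * b"
    unfolding Q_def by auto
  have "i \<ge> 1" using Pi unfolding P_def by simp
  have "a \<le> fib (i + 1)"
  proof (rule ccontr)
    assume *: "\<not> a \<le> fib (i + 1)"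
    define c where "c = a - fib (i + 1)"
    have "a = c + fib (i + 1)" using * by (simp add: c_def)
    then have "n = fib i * c + fib (i + 1) * (b + fib i)"
      using ab(3) by (simp add: algebra_simps)
    then have "Q c" unfolding Q_def using * ab(2) c_def by (auto intro!: exI[of _ "b + fib i"])
    then show False using min[of c] * fib_neq_0_nat[of "i + 1"] \<open>a \<ge> 1\<close> by (simp add: c_def)
  qed
  moreover have "b \<le> a"
  proof (rule ccontr)
    assume *: "\<not> b \<le> a"
    define c where "c = b - a"
    have "b = c + a" "c \<ge> 1" using * by (auto simp: c_def)
    then have "n = fib (i + 1) * c + fib (i + 1 + 1) * a"
      using ab(3) by (simp add: algebra_simps)
    then have "P (i + 1)" unfolding P_def using ab(1) \<open>c \<ge> 1\<close> le_add2[of 1 i] by blast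
    then show False using max[of "i + 1"] by simp
  qed
  ultimately show ?thesis
    using ab \<open>i \<ge> 1\<close> unfolding slow_rep_def by blast
qed

text \<open>Consecutive Fibonacci numbers are coprime, so two solutions differ by a multiple of
  \<open>(fib (i + 1), - fib i)\<close>. The bounds give \<open>a' - a > - fib (i + 1)\<close>,
  hence the multiple is nonnegative.\<close>

lemma fib_combination_unique:
  assumes eq: "fib i * a' + fib (i + 1) * b' = fib i * a + fib (i + 1) * b"
    and "a' \<ge> 1" "a \<le> fib (i + 1)"
  obtains k where "a' = a + k * fib (i + 1)" "b = b' + k * fib i"
proof -
  have "int (fib i) * (int a' - int a) = int (fib (i + 1)) * (int b - int b')"
    using arg_cong[OF eq, of int] by (simp add: algebra_simps)
  then have "int (fib (i + 1)) dvd int (fib i) * (int a' - int a)" by simp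
  moreover have "coprime (int (fib (i + 1))) (int (fib i))"
    using coprime_fib_Suc_nat[of i] by (simp add: coprime_commute)
  ultimately have "int (fib (i + 1)) dvd int a' - int a"
    using coprime_dvd_mult_right_iff by blast
  then obtain k where k: "int a' - int a = int (fib (i + 1)) * k" by (auto elim: dvdE)
  have pos: "int (fib (i + 1)) > 0" using fib_neq_0_nat[of "i + 1"] by simp
  have "k \<ge> 0"
  proof (rule ccontr)
    assume "\<not> k \<ge> 0"
    then have "int (fib (i + 1)) * k \<le> int (fib (i + 1)) * (-1)"
      using pos by (intro mult_left_mono) auto
    then show False using k assms(2,3) by linarith
  qed
  then have "int a' = int (a + nat k * fib (i + 1))" using k by (simp add: algebra_simps)
  then have a': "a' = a + nat k * fib (i + 1)" using of_nat_eq_iff by blast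
  have "fib (i + 1) * (b' + nat k * fib i) = fib (i + 1) * b"
    using eq unfolding a' by (simp add: algebra_simps)
  then have "b = b' + nat k * fib i" using fib_neq_0_nat[of "i + 1"] by simp
  then show ?thesis using a' that by blast
qed

lemma slow_rep_walk_index:
  assumes "slow_rep n i a b"
  shows "a \<ge> 1" "b \<ge> 1" "walk_index n a b = Some (i + 2)"
proof -
  show "a \<ge> 1" "b \<ge> 1" using assms by (auto simp: slow_rep_def)
  then show "walk_index n a b = Some (i + 2)"
    using walk_indexI[of a b i n] assms fib_walk_fib[of a b i] unfolding slow_rep_def by metis
qed

text \<open>A walk reaching \<open>n\<close> later would contain adjacent terms
  \<open>a' < b'\<close> that represent \<open>n\<close> with the same \<open>i\<close>. Uniqueness
  then gives \<open>b' \<le> b \<le> a \<le> a'\<close>, a contradiction.\<close>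

lemma slow_rep_max_walk_index:
  assumes "slow_rep n i a b"
  shows "max_walk_index n = i + 2"
  unfolding max_walk_index_def
proof (rule Max_eqI[OF finite_walk_indices])
  note rep = assms[unfolded slow_rep_def]
  show "i + 2 \<in> {s. \<exists>a\<ge>1. \<exists>b\<ge>1. walk_index n a b = Some s}"
    using slow_rep_walk_index[OF assms] by blast
  fix s assume "s \<in> {s. \<exists>a\<ge>1. \<exists>b\<ge>1. walk_index n a b = Some s}"
  then obtain a0 b0 where ab0: "a0 \<ge> 1" "b0 \<ge> 1" "walk_index n a0 b0 = Some s" by auto
  show "s \<le> i + 2"
  proof (rule ccontr)
    assume "\<not> s \<le> i + 2"
    \<comment> \<open>With this offset \<open>a'\<close> sits at index \<open>j + 2\<close>, at
      least 2, where the walk already increases strictly, and \<open>n\<close> is entry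
      \<open>i + 2\<close> of the walk from \<open>(a', b')\<close>.\<close>
    define j where "j = s - (i + 3)"
    have s: "s = j + i + 3" using \<open>\<not> s \<le> i + 2\<close> by (simp add: j_def)
    define a' b' where "a' = fib_walk a0 b0 (j + 2)" and "b' = fib_walk a0 b0 (j + 3)"
    have less: "a' < b'" unfolding a'_def b'_def by (rule fib_walk_less_Suc[OF ab0(1,2)])
    have "a' \<ge> 1" unfolding a'_def using fib_walk_ge[OF ab0(1,2), of "Suc j"] by simp
    have "fib_walk a0 b0 (Suc (Suc j + Suc i)) = n"
      using walk_indexD(2)[OF ab0] by (simp add: s numeral_3_eq_3)
    then have "fib_walk a' b' (i + 2) = n"
      unfolding a'_def b'_def using fib_walk_shift[of a0 b0 "Suc j" "Suc i"]
      by (simp add: numeral_3_eq_3)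
    then have "fib i * a' + fib (i + 1) * b' = fib i * a + fib (i + 1) * b"
      using rep by (simp only: fib_walk_fib)
    then obtain k where "a' = a + k * fib (i + 1)" "b = b' + k * fib i"
      using fib_combination_unique \<open>a' \<ge> 1\<close> rep by blast
    then show False using less rep by simp
  qed
qed

lemma slow_rep_good_pair:
  assumes "slow_rep n i a b"
  shows "good_pair n a b"
  using slow_rep_walk_index[OF assms] slow_rep_max_walk_index[OF assms]
  unfolding good_pair_def by simp

text \<open>A good pair need not be the canonical one, but it is a shift of it by a multiple of
  \<open>(fib (i + 1), - fib i)\<close>. By Cassini's identity each shift moves the next term by
  \<open>(-1) ^ i\<close>, so always away from the opposite side of phi n.\<close>

lemma good_pair_successor:
  assumes rep: "slow_rep n i a b" and good: "good_pair n a' b'"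
  obtains k where "int (fib_walk a' b' (max_walk_index n + 1)) =
    int (fib_walk a b (max_walk_index n + 1)) + (-1) ^ i * int k"
proof -
  note max = slow_rep_max_walk_index[OF rep]
  have "a' \<ge> 1" "b' \<ge> 1" "walk_index n a' b' = Some (i + 2)"
    using good max by (auto simp: good_pair_def)
  then have "fib i * a' + fib (i + 1) * b' = fib i * a + fib (i + 1) * b"
    using walk_indexD(2) rep unfolding slow_rep_def by (metis fib_walk_fib)
  then obtain k where k: "a' = a + k * fib (i + 1)" "b = b' + k * fib i"
    using fib_combination_unique \<open>a' \<ge> 1\<close> rep unfolding slow_rep_def by blast
  have succ: "fib_walk c d (max_walk_index n + 1) = fib (i + 1) * c + fib (i + 2) * d" for c d
    using fib_walk_fib[of c d "i + 1"] max by simp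
  have "int (fib (i + 1)) * int (fib (i + 1)) - int (fib (i + 2)) * int (fib i) = (-1) ^ i"
    using fib_Cassini_int[of i] by (simp add: power2_eq_square)
  then have "(-1) ^ i * int k
      = (int (fib (i + 1)) * int (fib (i + 1)) - int (fib (i + 2)) * int (fib i)) * int k"
    by simp
  then have "int (fib_walk a' b' (max_walk_index n + 1)) =
    int (fib_walk a b (max_walk_index n + 1)) + (-1) ^ i * int k"
    unfolding succ k by (simp add: algebra_simps)
  then show ?thesis using that by blast
qed

section \<open>Distance to the golden multiple\<close>

lemma golden_ratio_sq: "golden_ratio * golden_ratio = golden_ratio + 1"
  by (simp add: golden_ratio_def field_simps)

lemma golden_ratio_bounds: "809 / 500 < golden_ratio" "golden_ratio < 16181 / 10000"
proof -
  have "2.236 < sqrt 5" by (rule real_less_rsqrt) (simp add: power2_eq_square)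
  moreover have "sqrt 5 < 2.2362" by (rule real_less_lsqrt) (simp_all add: power2_eq_square)
  ultimately show "809 / 500 < golden_ratio" "golden_ratio < 16181 / 10000"
    unfolding golden_ratio_def by simp_all
qed

lemma golden_ratio_powers:
  "golden_ratio ^ 2 = golden_ratio + 1"
  "golden_ratio ^ 3 = 2 * golden_ratio + 1"
  "golden_ratio ^ 4 = 3 * golden_ratio + 2"
  "golden_ratio ^ 5 = 5 * golden_ratio + 3"
proof -
  have step: "golden_ratio ^ Suc k = (p + q) * golden_ratio + p"
    if "golden_ratio ^ k = p * golden_ratio + q" for k and p q :: real
  proof -
    have "golden_ratio ^ Suc k = p * (golden_ratio * golden_ratio) + q * golden_ratio"
      using that by (simp add: algebra_simps)
    then show ?thesis by (simp add: golden_ratio_sq algebra_simps)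
  qed
  show 2: "golden_ratio ^ 2 = golden_ratio + 1"
    by (simp add: power2_eq_square golden_ratio_sq)
  show 3: "golden_ratio ^ 3 = 2 * golden_ratio + 1" using step[of 2 1 1] 2 by simp
  show 4: "golden_ratio ^ 4 = 3 * golden_ratio + 2" using step[of 3 2 1] 3 by simp
  show "golden_ratio ^ 5 = 5 * golden_ratio + 3" using step[of 4 3 2] 4 by simp
qed

lemma fib_values:
  "fib 3 = 2" "fib 4 = 3" "fib 5 = 5" "fib 6 = 8" "fib 7 = 13" "fib 8 = 21"
  "fib 9 = 34" "fib 10 = 55" "fib 11 = 89" "fib 12 = 144" "fib 13 = 233" "fib 14 = 377"
  by (simp_all add: eval_nat_numeral)

lemma golden_ratio_power_fib: "golden_ratio ^ Suc i = golden_ratio * fib (Suc i) + fib i"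
  by (induction i) (simp_all add: algebra_simps golden_ratio_sq flip: mult.assoc)

text \<open>The error \<open>m - phi n\<close> of adjacent terms \<open>n\<close>, \<open>m\<close>
  is the component of the walk along the conjugate root -1/phi, so each step multiplies it by
  -1/phi. The induction passes from \<open>(a, b)\<close> to \<open>(b, a + b)\<close>.\<close>

lemma golden_ratio_walk_error:
  "golden_ratio ^ Suc i * (real (fib (i + 1) * a + fib (i + 2) * b)
     - golden_ratio * real (fib i * a + fib (i + 1) * b)) = (-1) ^ i * (golden_ratio * a - b)"
proof (induction i arbitrary: a b)
  case 0
  then show ?case by (simp add: algebra_simps golden_ratio_sq flip: mult.assoc)
next
  case (Suc i)
  have "golden_ratio ^ Suc (Suc i) * (real (fib (Suc i + 1) * a + fib (Suc i + 2) * b)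
      - golden_ratio * real (fib (Suc i) * a + fib (Suc i + 1) * b))
    = golden_ratio * (golden_ratio ^ Suc i * (real (fib (i + 1) * b + fib (i + 2) * (a + b))
      - golden_ratio * real (fib i * b + fib (i + 1) * (a + b))))"
    by (simp add: algebra_simps)
  also have "\<dots> = golden_ratio * ((-1) ^ i * (golden_ratio * b - (a + b)))"
    using Suc[of b "a + b"] by simp
  also have "\<dots> = (-1) ^ i * ((golden_ratio * golden_ratio) * b - golden_ratio * (a + b))"
    by (simp add: algebra_simps)
  also have "\<dots> = (-1) ^ Suc i * (golden_ratio * a - b)"
    unfolding golden_ratio_sq by (simp add: algebra_simps)
  finally show ?case .
qed

text \<open>These denominators arise on eliminating \<open>a\<close> or \<open>b\<close> from
  \<open>n = fib i * a + fib (i + 1) * b\<close> and \<open>phi^(i+1) x = phi a - b\<close>.\<close>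

definition scale :: "nat \<Rightarrow> real" where
  "scale i = golden_ratio ^ i * fib i"

text \<open>If \<open>x\<close> is the distance of the next term to \<open>\<phi> n\<close>, the two inequalities amount to \<open>0 < b\<close> and
  \<open>a \<le> fib (i + 1)\<close> for the starting pair \<open>(a, b)\<close>.\<close>

definition window :: "nat \<Rightarrow> nat \<Rightarrow> real \<Rightarrow> bool" where
  "window i n x \<longleftrightarrow> x < real n / scale i \<and> x + real n / scale (i + 1) \<le> 1"

definition down_dist :: "nat \<Rightarrow> real" where
  "down_dist n = frac (golden_ratio * real n)"

definition up_dist :: "nat \<Rightarrow> real" where
  "up_dist n = frac (- (golden_ratio * real n))"

lemma scale_pos: "i \<ge> 1 \<Longrightarrow> scale i > 0"
  using golden_ratio_bounds fib_neq_0_nat[of i] by (auto simp: scale_def)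

lemma real_fib_ge_1: "i \<ge> 1 \<Longrightarrow> real (fib i) \<ge> 1"
  using fib_neq_0_nat[of i] by simp

lemma scale_mono: "i \<le> j \<Longrightarrow> scale i \<le> scale j"
  using golden_ratio_bounds unfolding scale_def
  by (intro mult_mono power_increasing) (auto simp: fib_mono)

text \<open>The error formula gives \<open>phi^(i+1) x = phi a - b\<close>. Positivity comes from
  \<open>b \<le> a\<close>, the two inequalities of \<open>window\<close> from
  \<open>b \<ge> 1\<close> and \<open>a \<le> fib (i + 1)\<close>, and \<open>x < 1\<close> from the
  second of them.\<close>

lemma slow_rep_error:
  assumes "slow_rep n i a b"
  defines "m \<equiv> fib (i + 1) * a + fib (i + 2) * b"
  defines "x \<equiv> (-1) ^ i * (real m - golden_ratio * real n)"
  shows "0 < x" "window i n x" "x < 1"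
proof -
  note rep = assms(1)[unfolded slow_rep_def]
  have g: "golden_ratio > 1" "golden_ratio > 0" using golden_ratio_bounds by auto
  have pw: "golden_ratio ^ Suc i > 0" using g by simp
  have "golden_ratio ^ Suc i * x = (-1) ^ i * (golden_ratio ^ Suc i *
      (real (fib (i + 1) * a + fib (i + 2) * b)
        - golden_ratio * real (fib i * a + fib (i + 1) * b)))"
    using rep unfolding x_def m_def by simp
  also have "\<dots> = golden_ratio * a - b"
    unfolding golden_ratio_walk_error by (simp flip: mult.assoc power_add)
  finally have x: "golden_ratio ^ Suc i * x = golden_ratio * a - b" .
  have "1 * real a < golden_ratio * real a"
    using g rep by (intro mult_strict_right_mono) auto
  moreover have "real b \<le> real a" using rep by simp
  ultimately have "golden_ratio ^ Suc i * x > 0" unfolding x by linarith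
  then show "0 < x" using pw by (rule zero_less_mult_pos)
  have f: "real (fib i) > 0" "real (fib (i + 1)) > 0"
    using fib_neq_0_nat[of i] fib_neq_0_nat[of "i + 1"] rep by simp_all
  have n: "real n = fib i * a + fib (i + 1) * b" using rep by simp
  have "golden_ratio * (x * scale i) = (golden_ratio ^ Suc i * x) * fib i"
    unfolding scale_def by (simp add: algebra_simps)
  also have "\<dots> < golden_ratio * real n"
  proof -
    \<comment> \<open>These two terms add up to the difference of the two sides.\<close>
    have "golden_ratio * (fib (i + 1) * b) > 0" "real (fib i) * b > 0"
      using f g rep by (auto intro!: mult_pos_pos simp del: fib.simps)
    then show ?thesis unfolding x n by (simp add: algebra_simps del: fib.simps)
  qed
  finally have "x * scale i < real n" using g by simp
  then have w1: "x < real n / scale i"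
    using scale_pos[of i] rep by (simp add: field_simps)
  have "x * scale (i + 1) + real n = (golden_ratio ^ Suc i * x) * fib (i + 1) + real n"
    unfolding scale_def by (simp add: algebra_simps)
  also have "\<dots> = (golden_ratio * fib (Suc i) + fib i) * a"
    unfolding x n by (simp add: algebra_simps)
  also have "\<dots> = golden_ratio ^ Suc i * a" unfolding golden_ratio_power_fib ..
  also have "\<dots> \<le> scale (i + 1)"
    using rep golden_ratio_bounds unfolding scale_def Suc_eq_plus1
    by (intro mult_left_mono) (auto simp del: fib.simps)
  finally have w2: "x + real n / scale (i + 1) \<le> 1"
    using scale_pos[of "i + 1"] by (simp add: field_simps)
  then show "window i n x" using w1 unfolding window_def by simp
  have "n > 0" using rep f by (auto simp: n[symmetric])
  then have "real n / scale (i + 1) > 0" using scale_pos[of "i + 1"] by simp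
  then show "x < 1" using w2 by linarith
qed

lemma frac_eqI:
  fixes x y :: real
  assumes "x = of_int z + y" "0 \<le> y" "y < 1"
  shows "frac x = y"
  using assms by (auto simp: frac_unique_iff)

text \<open>Adding \<open>h\<close> rotates the fractional part by \<open>h\<close> phi modulo 1.
  The integer \<open>z\<close> records the wrap-around, and the range conditions certify that it was
  chosen correctly.\<close>

lemma down_dist_add:
  assumes "t = real h * golden_ratio + of_int z" "0 \<le> down_dist n + t" "down_dist n + t < 1"
  shows "down_dist (n + h) = down_dist n + t"
  unfolding down_dist_def
  by (rule frac_eqI[of _ "\<lfloor>golden_ratio * real n\<rfloor> - z"])
    (use assms in \<open>auto simp: down_dist_def frac_def algebra_simps\<close>)

lemma up_dist_add:
  assumes "t = of_int z - real h * golden_ratio" "0 \<le> up_dist n + t" "up_dist n + t < 1"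
  shows "up_dist (n + h) = up_dist n + t"
  unfolding up_dist_def
  by (rule frac_eqI[of _ "\<lfloor>- (golden_ratio * real n)\<rfloor> - z"])
    (use assms in \<open>auto simp: up_dist_def frac_def algebra_simps\<close>)

lemma dist_bounds: "0 \<le> down_dist n" "down_dist n < 1" "0 \<le> up_dist n" "up_dist n < 1"
  by (auto simp: down_dist_def up_dist_def frac_lt_1)

text \<open>Positivity of one distance rules out an integral phi n, for which both would be
  0.\<close>

lemma down_dist_plus_up_dist:
  assumes "down_dist n > 0 \<or> up_dist n > 0"
  shows "down_dist n + up_dist n = 1"
  using assms frac_neg[of "golden_ratio * real n"]
  by (auto simp: down_dist_def up_dist_def split: if_splits)

text \<open>One formula serves both parities: the fractional part is \<open>down_dist n\<close> for
  odd \<open>i\<close> and \<open>up_dist n\<close> for even \<open>i\<close>.\<close>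

lemma slow_rep_window:
  assumes "slow_rep n i a b"
  shows "0 < frac ((-1) ^ Suc i * golden_ratio * real n)"
    "window i n (frac ((-1) ^ Suc i * golden_ratio * real n))"
proof -
  define m where "m = fib (i + 1) * a + fib (i + 2) * b"
  define x where "x = (-1) ^ i * (real m - golden_ratio * real n)"
  note e = slow_rep_error[OF assms, folded m_def, folded x_def]
  have "frac ((-1) ^ Suc i * golden_ratio * real n) = x"
    by (rule frac_eqI[of _ "(-1) ^ Suc i * int m"]) (use e in \<open>auto simp: x_def algebra_simps\<close>)
  then show "0 < frac ((-1) ^ Suc i * golden_ratio * real n)"
    "window i n (frac ((-1) ^ Suc i * golden_ratio * real n))"
    using e by auto
qed

lemma slow_rep_ge_2:
  assumes "slow_rep n i a b"
  shows "n \<ge> 2"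
proof -
  note rep = assms[unfolded slow_rep_def]
  have "fib i \<ge> 1" "fib (i + 1) \<ge> 1" "a \<ge> 1" "b \<ge> 1"
    using fib_neq_0_nat[of i] fib_neq_0_nat[of "i + 1"] rep by auto
  then have "fib i * a \<ge> 1 * 1" "fib (i + 1) * b \<ge> 1 * 1" by (intro mult_le_mono; simp)+
  then show ?thesis using rep by linarith
qed

lemma slow_rep_successor:
  assumes rep: "slow_rep n i a b"
  defines "m \<equiv> fib_walk a b (max_walk_index n + 1)"
  shows "odd i \<Longrightarrow> int m = \<lfloor>golden_ratio * real n\<rfloor>"
    and "even i \<Longrightarrow> int m = \<lceil>golden_ratio * real n\<rceil>"
    and "\<lfloor>golden_ratio * real n\<rfloor> < \<lceil>golden_ratio * real n\<rceil>"
proof -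
  have m: "m = fib (i + 1) * a + fib (i + 2) * b"
    using fib_walk_fib[of a b "i + 1"] slow_rep_max_walk_index[OF rep] by (simp add: m_def)
  note e = slow_rep_error[OF rep, folded m]
  show o: "int m = \<lfloor>golden_ratio * real n\<rfloor>" if "odd i"
    using e that by (intro floor_unique[symmetric]) auto
  show ev: "int m = \<lceil>golden_ratio * real n\<rceil>" if "even i"
    using e that by (intro ceiling_unique[symmetric]) auto
  show "\<lfloor>golden_ratio * real n\<rfloor> < \<lceil>golden_ratio * real n\<rceil>"
  proof (cases "even i")
    case True
    then show ?thesis using ev[symmetric] e by (simp add: floor_less_iff)
  next
    case False
    then show ?thesis using o[symmetric] e by (simp add: less_ceiling_iff)
  qed
qed

text \<open>For even \<open>i\<close> the canonical pair continues with the ceiling, and every other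
  good pair continues with something at least as large, so none of them reaches the floor.\<close>

theorem down_integers_iff: "n \<in> down_integers \<longleftrightarrow> (\<exists>i a b. slow_rep n i a b \<and> odd i)"
proof
  assume "n \<in> down_integers"
  then obtain a' b' where "n \<ge> 2" and good: "good_pair n a' b'"
    and floor: "int (fib_walk a' b' (max_walk_index n + 1)) = \<lfloor>golden_ratio * real n\<rfloor>"
    by (auto simp: down_integers_def)
  obtain i a b where rep: "slow_rep n i a b" using slow_rep_exists[OF \<open>n \<ge> 2\<close>] by blast
  have "odd i"
  proof
    assume "even i"
    then show False
      using good_pair_successor[OF rep good] slow_rep_successor[OF rep] floor by force
  qed
  then show "\<exists>i a b. slow_rep n i a b \<and> odd i" using rep by blast
next
  assume "\<exists>i a b. slow_rep n i a b \<and> odd i"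
  then show "n \<in> down_integers"
    unfolding down_integers_def
    using slow_rep_ge_2 slow_rep_good_pair slow_rep_successor(1) by blast
qed

theorem up_integers_iff: "n \<in> up_integers \<longleftrightarrow> (\<exists>i a b. slow_rep n i a b \<and> even i)"
proof
  assume "n \<in> up_integers"
  then obtain a' b' where "n \<ge> 2" and good: "good_pair n a' b'"
    and ceil: "int (fib_walk a' b' (max_walk_index n + 1)) = \<lceil>golden_ratio * real n\<rceil>"
    by (auto simp: up_integers_def)
  obtain i a b where rep: "slow_rep n i a b" using slow_rep_exists[OF \<open>n \<ge> 2\<close>] by blast
  have "even i"
  proof (rule ccontr)
    assume "odd i"
    then show False
      using good_pair_successor[OF rep good] slow_rep_successor[OF rep] ceil by force
  qed
  then show "\<exists>i a b. slow_rep n i a b \<and> even i" using rep by blast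
next
  assume "\<exists>i a b. slow_rep n i a b \<and> even i"
  then show "n \<in> up_integers"
    unfolding up_integers_def
    using slow_rep_ge_2 slow_rep_good_pair slow_rep_successor(2) by blast
qed

section \<open>Membership in terms of windows\<close>

lemma down_integers_windowE:
  assumes "n \<in> down_integers"
  obtains i where "odd i" "i \<ge> 1" "0 < down_dist n" "window i n (down_dist n)"
proof -
  obtain i a b where "slow_rep n i a b" "odd i" using assms down_integers_iff by auto
  then show ?thesis
    using slow_rep_window[of n i a b] that[of i] by (simp add: down_dist_def odd_pos Suc_leI)
qed

lemma up_integers_windowE:
  assumes "n \<in> up_integers"
  obtains i where "even i" "i \<ge> 2" "0 < up_dist n" "window i n (up_dist n)"
proof -
  obtain i a b where rep: "slow_rep n i a b" "even i" using assms up_integers_iff by auto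
  then have "i \<noteq> 0" "i \<noteq> 1" by (auto simp: slow_rep_def)
  then have "i \<ge> 2" by linarith
  then show ?thesis using slow_rep_window[of n i a b] rep that[of i] by (simp add: up_dist_def)
qed

lemma divide_scale_le:
  assumes "j \<le> i" "j \<ge> 1" "h \<ge> 0"
  shows "h / scale i \<le> h / scale j"
  using assms scale_mono[of j i] scale_pos[of i] scale_pos[of j]
  by (intro divide_left_mono) auto

text \<open>If \<open>i < j\<close>, then
  \<open>y < n / scale j \<le> n / scale (i + 1) \<le> 1 - x = y\<close>, which is absurd.\<close>

lemma windows_disjoint:
  assumes "window i n x" "window j n y" "x + y = 1" "i \<ge> 1" "j \<ge> 1"
  shows "i = j"
proof -
  have *: False if "window i n x" "window j n y" "x + y = 1" "i < j" for i j and x y :: real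
    using divide_scale_le[of "i + 1" j "real n"] that unfolding window_def by simp
  show ?thesis
    using *[of i x j y] *[of j y i x] assms by (cases i j rule: linorder_cases) auto
qed

lemma down_or_up: "n \<ge> 2 \<Longrightarrow> n \<in> down_integers \<or> n \<in> up_integers"
  using slow_rep_exists down_integers_iff up_integers_iff by blast

lemma down_integers_ge_2: "n \<in> down_integers \<Longrightarrow> n \<ge> 2"
  by (auto simp: down_integers_def)

lemma up_integers_ge_2: "n \<in> up_integers \<Longrightarrow> n \<ge> 2"
  by (auto simp: up_integers_def)

lemma down_up_windows_incompatible:
  assumes "odd i" "window i n (down_dist n)" "even j" "j \<ge> 2" "window j n (up_dist n)"
    "0 < down_dist n \<or> 0 < up_dist n"
  shows False
proof -
  have "i \<ge> 1" using \<open>odd i\<close> by (simp add: odd_pos Suc_leI)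
  then have "i = j"
    using windows_disjoint[OF assms(2,5)] down_dist_plus_up_dist[OF assms(6)] assms(4) by simp
  then show False using assms by simp
qed

text \<open>No starting pair is rebuilt from the window: \<open>n\<close> lies in one of the two
  sets, and membership in the other would supply a window of even index, incompatible with the odd
  one at hand.\<close>

lemma down_integersI:
  assumes "n \<ge> 2" "odd i" "window i n (down_dist n)"
  shows "n \<in> down_integers"
proof (rule ccontr)
  assume "n \<notin> down_integers"
  then have "n \<in> up_integers" using down_or_up assms(1) by blast
  then obtain j where "even j" "j \<ge> 2" "0 < up_dist n" "window j n (up_dist n)"
    by (rule up_integers_windowE)
  then show False using down_up_windows_incompatible[OF assms(2,3)] by blast
qed

lemma up_integersI:
  assumes "n \<ge> 2" "even i" "i \<ge> 2" "window i n (up_dist n)"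
  shows "n \<in> up_integers"
proof (rule ccontr)
  assume "n \<notin> up_integers"
  then have "n \<in> down_integers" using down_or_up assms(1) by blast
  then obtain j where "odd j" "0 < down_dist n" "window j n (down_dist n)"
    by (rule down_integers_windowE)
  then show False using down_up_windows_incompatible assms(2-4) by blast
qed

lemma not_down_and_up: "n \<in> down_integers \<Longrightarrow> n \<notin> up_integers"
  using down_up_windows_incompatible by (metis down_integers_windowE up_integers_windowE)

section \<open>Uniform thresholds and perturbation of windows\<close>

lemma scale_unbounded: "\<exists>k. scale (p + 2 * k + 2) \<ge> x"
proof -
  obtain k where "x < golden_ratio ^ k"
    using real_arch_pow golden_ratio_bounds(1) by fastforce
  also have "\<dots> \<le> golden_ratio ^ (p + 2 * k + 2)"
    using golden_ratio_bounds by (intro power_increasing) auto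
  also have "\<dots> \<le> scale (p + 2 * k + 2)"
  proof -
    have "golden_ratio ^ (p + 2 * k + 2) * 1 \<le> golden_ratio ^ (p + 2 * k + 2) * fib (p + 2 * k + 2)"
      using golden_ratio_bounds by (intro mult_left_mono real_fib_ge_1) auto
    then show ?thesis unfolding scale_def by simp
  qed
  finally show ?thesis by (intro exI[of _ k]) simp
qed

text \<open>The powers \<open>\<phi>\<^sup>-\<^sup>1, \<dots>, \<phi>\<^sup>-\<^sup>5\<close> occur below as \<open>\<phi> - 1\<close>, \<open>2 - \<phi>\<close>, \<open>2 \<phi> - 3\<close>, \<open>5 - 3 \<phi>\<close>, \<open>5 \<phi> - 8\<close>.\<close>

lemma scale_values:
  "1 / scale 1 = golden_ratio - 1"
  "1 / scale 2 = 2 - golden_ratio"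
  "2 / scale 3 = 2 * golden_ratio - 3"
  "3 / scale 4 = 5 - 3 * golden_ratio"
  "5 / scale 5 = 5 * golden_ratio - 8"
proof -
  have mult: "(p * golden_ratio + q) * (r * golden_ratio + t)
      = (p * r + p * t + q * r) * golden_ratio + (p * r + q * t)" for p q r t :: real
  proof -
    have "(p * golden_ratio + q) * (r * golden_ratio + t)
        = p * r * (golden_ratio * golden_ratio) + (p * t + q * r) * golden_ratio + q * t"
      by (simp add: algebra_simps)
    then show ?thesis unfolding golden_ratio_sq by (simp add: algebra_simps)
  qed
  have quot: "c / scale i = v" if "v * scale i = c" "i \<ge> 1" for c v i
    using that scale_pos[of i] by (simp add: field_simps)
  show "1 / scale 1 = golden_ratio - 1"
    using mult[of 1 "-1" 1 0] by (intro quot) (simp_all add: scale_def)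
  show "1 / scale 2 = 2 - golden_ratio"
    using mult[of "-1" 2 1 1] by (intro quot) (simp_all add: scale_def golden_ratio_powers)
  show "2 / scale 3 = 2 * golden_ratio - 3"
    using mult[of 2 "-3" 4 2]
    by (intro quot) (simp_all add: scale_def golden_ratio_powers fib_values)
  show "3 / scale 4 = 5 - 3 * golden_ratio"
    using mult[of "-3" 5 9 6]
    by (intro quot) (simp_all add: scale_def golden_ratio_powers fib_values)
  show "5 / scale 5 = 5 * golden_ratio - 8"
    using mult[of 5 "-8" 25 15]
    by (intro quot) (simp_all add: scale_def golden_ratio_powers fib_values)
qed

text \<open>Here \<open>p\<close> fixes the parity of the index. For \<open>y\<close> = phi^-3 take
  the first \<open>k\<close> at which \<open>n / scale (p + 2 * k + 2)\<close> is at most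
  \<open>y\<close>. Minimality gives the first inequality of \<open>window\<close>; the second holds
  because one step of the index multiplies \<open>scale\<close> by at most 2 phi.\<close>

lemma window_exists:
  assumes "p \<in> {1, 2}" "n \<ge> 1" "x \<le> 2 * golden_ratio - 3"
  shows "\<exists>k. window (p + 2 * k) n x"
proof -
  define y where "y = 2 * golden_ratio - 3"
  have y: "y > 0" using golden_ratio_bounds unfolding y_def by simp
  define P where "P = (\<lambda>k. real n / scale (p + 2 * k + 2) \<le> y)"
  have "\<exists>k. P k"
  proof -
    obtain k where "scale (p + 2 * k + 2) \<ge> real n / y" using scale_unbounded by blast
    then have "P k"
      unfolding P_def using y scale_pos[of "p + 2 * k + 2"] by (simp add: field_simps)
    then show ?thesis by blast
  qed
  define k where "k = (LEAST k. P k)"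
  have "P k" unfolding k_def using \<open>\<exists>k. P k\<close> by (rule LeastI_ex)
  \<comment> \<open>For \<open>k = 0\<close> there is no predecessor; instead
    \<open>1 / scale p\<close> is phi^-1 or phi^-2, which exceeds phi^-3.\<close>
  have "real n / scale (p + 2 * k) > y"
  proof (cases k)
    case 0
    have "1 / scale p > y"
      using assms(1) golden_ratio_bounds scale_values unfolding y_def by auto
    also have "1 / scale p \<le> real n / scale p"
      using assms(1,2) scale_pos[of p] by (intro divide_right_mono) auto
    finally show ?thesis using 0 by simp
  next
    case (Suc l)
    then have "l < k" by simp
    then have "\<not> P l" unfolding k_def by (rule not_less_Least)
    then show ?thesis unfolding P_def Suc by simp
  qed
  moreover have "real n / scale (p + 2 * k + 1) \<le> 1 - y"
  proof -
    define i where "i = p + 2 * k + 1"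
    have "i \<ge> 1" by (simp add: i_def)
    have "fib (i + 1) \<le> 2 * fib i"
      using fib_Suc_mono[of "p + 2 * k"] by (simp add: i_def)
    then have "real (fib (i + 1)) \<le> 2 * real (fib i)" by linarith
    then have "scale (i + 1) \<le> golden_ratio ^ (i + 1) * (2 * real (fib i))"
      unfolding scale_def using golden_ratio_bounds by (intro mult_left_mono) auto
    also have "\<dots> = 2 * golden_ratio * scale i"
      unfolding scale_def by simp
    finally have s: "scale (i + 1) \<le> 2 * golden_ratio * scale i" .
    have "real n \<le> y * scale (i + 1)"
      using \<open>P k\<close> scale_pos[of "i + 1"] unfolding P_def i_def by (simp add: field_simps)
    also have "\<dots> \<le> y * (2 * golden_ratio * scale i)"
      using s y by (intro mult_left_mono) auto
    \<comment> \<open>The identity \<open>2 phi y = 1 - y\<close> is what makes phi^-3 a suitable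
      threshold.\<close>
    also have "\<dots> = (1 - y) * scale i"
    proof -
      have "y * (2 * golden_ratio) = 4 * (golden_ratio * golden_ratio) - 6 * golden_ratio"
        unfolding y_def by (simp add: algebra_simps)
      then have "y * (2 * golden_ratio) = 1 - y" unfolding golden_ratio_sq y_def by simp
      then show ?thesis by (metis mult.assoc)
    qed
    finally show ?thesis using scale_pos[OF \<open>i \<ge> 1\<close>] unfolding i_def[symmetric]
      by (simp add: field_simps)
  qed
  ultimately show ?thesis using assms(3) unfolding window_def y_def
    by (intro exI[of _ k]) auto
qed

lemma down_integers_of_small:
  assumes "n \<ge> 2" "down_dist n \<le> 2 * golden_ratio - 3"
  shows "n \<in> down_integers"
proof -
  obtain k where "window (1 + 2 * k) n (down_dist n)"
    using window_exists[of 1 n, OF _ _ assms(2)] assms(1) by auto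
  then show ?thesis using assms(1) by (intro down_integersI[of _ "1 + 2 * k"]) auto
qed

lemma up_integers_of_small:
  assumes "n \<ge> 2" "up_dist n \<le> 2 * golden_ratio - 3"
  shows "n \<in> up_integers"
proof -
  obtain k where "window (2 + 2 * k) n (up_dist n)"
    using window_exists[of 2 n, OF _ _ assms(2)] assms(1) by auto
  then show ?thesis using assms(1) by (intro up_integersI[of _ "2 + 2 * k"]) auto
qed

text \<open>At distance 1 - phi^-3 or more from the floor, the ceiling is within phi^-3, which
  forces membership in the other set.\<close>

lemma down_integers_dist_less:
  assumes "n \<in> down_integers"
  shows "down_dist n < 4 - 2 * golden_ratio"
proof (rule ccontr)
  assume *: "\<not> ?thesis"
  then have "down_dist n > 0" using golden_ratio_bounds by linarith
  then have "up_dist n \<le> 2 * golden_ratio - 3" using down_dist_plus_up_dist[of n] * by linarith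
  then show False
    using up_integers_of_small[of n] down_integers_ge_2 not_down_and_up assms by blast
qed

lemma up_integers_dist_less:
  assumes "n \<in> up_integers"
  shows "up_dist n < 4 - 2 * golden_ratio"
proof (rule ccontr)
  assume *: "\<not> ?thesis"
  then have "up_dist n > 0" using golden_ratio_bounds by linarith
  then have "down_dist n \<le> 2 * golden_ratio - 3" using down_dist_plus_up_dist[of n] * by linarith
  then show False
    using down_integers_of_small[of n] up_integers_ge_2 not_down_and_up assms by blast
qed

text \<open>Growing \<open>n\<close> only strains the second inequality, by
  \<open>h / scale (i + 1)\<close>, and the drop from \<open>x\<close> to \<open>y\<close> pays for
  it. The index is kept, hence also the parity.\<close>

lemma window_increase:
  assumes "window i n x" "i \<ge> 1" "real h / scale (i + 1) \<le> x - y"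
  shows "window i (n + h) y"
proof -
  have "real h / scale i \<ge> 0" "real h / scale (i + 1) \<ge> 0"
    using scale_pos[of i] scale_pos[of "i + 1"] assms(2) by auto
  then show ?thesis using assms unfolding window_def of_nat_add add_divide_distrib by linarith
qed

text \<open>Shrinking \<open>n\<close> only strains the first inequality, by
  \<open>h / scale i\<close>.\<close>

lemma window_decrease:
  assumes "window i m x" "m = n + h" "i \<ge> 1" "real h / scale i \<le> x - y"
  shows "window i n y"
proof -
  have "real h / scale i \<ge> 0" "real h / scale (i + 1) \<ge> 0"
    using scale_pos[of i] scale_pos[of "i + 1"] assms(3) by auto
  then show ?thesis using assms unfolding window_def assms(2) of_nat_add add_divide_distrib by linarith
qed

text \<open>A smaller index would make \<open>n / scale (i + 1)\<close> exceed 1. Lower bounds on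
  the index keep the cost of perturbing a window small.\<close>

lemma window_index_ge:
  assumes "window i n x" "x > 0" "scale j < real n"
  shows "j \<le> i"
proof (rule ccontr)
  assume "\<not> j \<le> i"
  then have "scale (i + 1) < real n" using scale_mono[of "i + 1" j] assms(3) by simp
  moreover have "real n / scale (i + 1) \<le> 1" using assms unfolding window_def by linarith
  ultimately show False using scale_pos[of "i + 1"] by (simp add: field_simps)
qed

text \<open>The thresholds 3, 9 and 21 are \<open>scale 2\<close>, \<open>scale 3\<close> and
  \<open>scale 4\<close> rounded up.\<close>

lemma scale_less:
  "n \<ge> 3 \<Longrightarrow> scale 2 < real n"
  "n \<ge> 9 \<Longrightarrow> scale 3 < real n"
  "n \<ge> 21 \<Longrightarrow> scale 4 < real n"
proof -
  have "scale 2 = golden_ratio + 1" "scale 3 = 4 * golden_ratio + 2" "scale 4 = 9 * golden_ratio + 6"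
    by (simp_all add: scale_def golden_ratio_powers fib_values)
  then have "scale 2 < 3" "scale 3 < 9" "scale 4 < 21" using golden_ratio_bounds by simp_all
  moreover have "real n \<ge> real k" if "n \<ge> k" for k using that by simp
  ultimately show "n \<ge> 3 \<Longrightarrow> scale 2 < real n" "n \<ge> 9 \<Longrightarrow> scale 3 < real n"
    "n \<ge> 21 \<Longrightarrow> scale 4 < real n"
    by fastforce+
qed

section \<open>Return times\<close>

lemma down_integers_plus_3:
  assumes "n \<in> down_integers" "n \<ge> 3" "down_dist n \<ge> 5 - 3 * golden_ratio"
  shows "n + 3 \<in> down_integers"
proof -
  obtain i where i: "odd i" "i \<ge> 1" "0 < down_dist n" "window i n (down_dist n)"
    using down_integers_windowE[OF assms(1)] .
  have "2 \<le> i" using window_index_ge i scale_less(1) assms(2) by blast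
  then have "i \<ge> 3" using \<open>odd i\<close> by (cases "i = 2") auto
  have f: "down_dist (n + 3) = down_dist n + (3 * golden_ratio - 5)"
    by (rule down_dist_add[where z = "-5"])
      (use assms(3) dist_bounds[of n] golden_ratio_bounds in \<open>simp_all\<close>)
  \<comment> \<open>In general \<open>fib k / scale k\<close> is phi^-k. For \<open>k = 4\<close>
    this cost equals the drop phi^-4 of the distance, so the perturbation is just
    affordable.\<close>
  have "real 3 / scale (i + 1) \<le> 5 - 3 * golden_ratio"
    using divide_scale_le[of 4 "i + 1" 3] scale_values(4) \<open>i \<ge> 3\<close> by simp
  then have "window i (n + 3) (down_dist (n + 3))"
    using f i by (intro window_increase) auto
  then show ?thesis using \<open>odd i\<close> assms(2) by (intro down_integersI[of _ i]) auto
qed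

lemma down_integers_minus:
  assumes "m \<in> down_integers" "n \<ge> 2" "scale j < real m" "even j" "j \<ge> 2" "m = n + h"
    and "real h / scale (j + 1) \<le> down_dist m - down_dist n"
  shows "n \<in> down_integers"
proof -
  obtain i where i: "odd i" "i \<ge> 1" "0 < down_dist m" "window i m (down_dist m)"
    using down_integers_windowE[OF assms(1)] .
  have "j \<le> i" using window_index_ge i assms(3) by blast
  \<comment> \<open>Parity gains one index, which lowers the cost to
    \<open>h / scale (j + 1)\<close>.\<close>
  then have "i \<ge> j + 1" using \<open>odd i\<close> \<open>even j\<close> by (cases "i = j") auto
  then have "real h / scale i \<le> real h / scale (j + 1)" by (intro divide_scale_le) auto
  then have "window i n (down_dist n)"
    using assms(7) by (intro window_decrease[OF i(4) assms(6) i(2)]) linarith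
  then show ?thesis using \<open>odd i\<close> assms(2) by (intro down_integersI)
qed

text \<open>If the distance is at least phi^-4, then 3 is a return. Otherwise adding 5 raises it by
  phi^-5 and leaves it below phi^-4 + phi^-5 = phi^-3, where membership is automatic.\<close>

lemma down_integers_return:
  assumes "n \<in> down_integers" "n \<ge> 3"
  shows "n + 3 \<in> down_integers \<or> n + 5 \<in> down_integers"
proof (cases "down_dist n \<ge> 5 - 3 * golden_ratio")
  case True
  then show ?thesis using down_integers_plus_3[OF assms] by simp
next
  case False
  have "down_dist (n + 5) = down_dist n + (5 * golden_ratio - 8)"
    by (rule down_dist_add[where z = "-8"])
      (use False dist_bounds[of n] golden_ratio_bounds in \<open>simp_all\<close>)
  then have "n + 5 \<in> down_integers" using False by (intro down_integers_of_small) auto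
  then show ?thesis ..
qed

text \<open>This excludes the gap 4. For distance below phi^-4, going back from \<open>n + 4\<close>
  to \<open>n + 2\<close> lowers the distance by phi^-3, which is the cost
  \<open>2 / scale 3\<close>.\<close>

lemma down_integers_4:
  assumes "n \<in> down_integers" "n + 4 \<in> down_integers" "n \<ge> 3"
  shows "n + 2 \<in> down_integers \<or> n + 3 \<in> down_integers"
proof (cases "down_dist n \<ge> 5 - 3 * golden_ratio")
  case True
  then show ?thesis using down_integers_plus_3[OF assms(1,3)] by simp
next
  case False
  have "down_dist (n + 4) = down_dist n + (4 * golden_ratio - 6)"
    by (rule down_dist_add[where z = "-6"])
      (use False dist_bounds[of n] golden_ratio_bounds in \<open>simp_all\<close>)
  moreover have "down_dist (n + 2) = down_dist n + (2 * golden_ratio - 3)"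
    by (rule down_dist_add[where z = "-3"])
      (use False dist_bounds[of n] golden_ratio_bounds in \<open>simp_all\<close>)
  ultimately have "real 2 / scale (2 + 1) \<le> down_dist (n + 4) - down_dist (n + 2)"
    using scale_values(3) by simp
  then have "n + 2 \<in> down_integers"
    using assms(3) scale_less(1)[of "n + 4"]
    by (intro down_integers_minus[OF assms(2), of _ 2 2]) simp_all
  then show ?thesis ..
qed

text \<open>After adding 2 the distance is at least phi^-3, hence large enough for a further return
  by 3.\<close>

lemma down_integers_2_5:
  assumes "n \<in> down_integers" "n + 2 \<in> down_integers"
  shows "n + 5 \<in> down_integers"
proof -
  have "down_dist (n + 2) = down_dist n + (2 * golden_ratio - 3)"
    by (rule down_dist_add[where z = "-3"])
      (use down_integers_dist_less[OF assms(1)] dist_bounds[of n] golden_ratio_bounds in \<open>simp_all\<close>)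
  then have "down_dist (n + 2) \<ge> 5 - 3 * golden_ratio"
    using golden_ratio_bounds dist_bounds[of n] by linarith
  then have "n + 2 + 3 \<in> down_integers"
    using down_integers_ge_2[OF assms(1)] by (intro down_integers_plus_3[OF assms(2)]) auto
  then show ?thesis by (simp add: add.commute)
qed

text \<open>For distance below phi^-4, going back from \<open>n + 7\<close> to \<open>n + 2\<close>
  lowers it by phi^-5 = \<open>5 / scale 5\<close>. The bound 14 puts \<open>n + 7\<close> above
  \<open>scale 4\<close>, so that the odd index is at least 5.\<close>

lemma down_integers_5_2:
  assumes "n \<in> down_integers" "n + 7 \<in> down_integers" "n \<ge> 14"
  shows "n + 2 \<in> down_integers \<or> n + 3 \<in> down_integers"
proof (cases "down_dist n \<ge> 5 - 3 * golden_ratio")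
  case True
  then show ?thesis using down_integers_plus_3[OF assms(1)] assms(3) by simp
next
  case False
  have "down_dist (n + 7) = down_dist n + (7 * golden_ratio - 11)"
    by (rule down_dist_add[where z = "-11"])
      (use False dist_bounds[of n] golden_ratio_bounds in \<open>simp_all\<close>)
  moreover have "down_dist (n + 2) = down_dist n + (2 * golden_ratio - 3)"
    by (rule down_dist_add[where z = "-3"])
      (use False dist_bounds[of n] golden_ratio_bounds in \<open>simp_all\<close>)
  ultimately have "real 5 / scale (4 + 1) \<le> down_dist (n + 7) - down_dist (n + 2)"
    using scale_values(5) by simp
  then have "n + 2 \<in> down_integers"
    using assms(3) scale_less(3)[of "n + 7"]
    by (intro down_integers_minus[OF assms(2), of _ 4 5]) simp_all
  then show ?thesis ..
qed

section \<open>Return times of the up-integers\<close>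

lemma up_integers_plus_2:
  assumes "n \<in> up_integers" "up_dist n \<ge> 2 * golden_ratio - 3"
  shows "n + 2 \<in> up_integers"
proof -
  obtain i where i: "even i" "i \<ge> 2" "0 < up_dist n" "window i n (up_dist n)"
    using up_integers_windowE[OF assms(1)] .
  have f: "up_dist (n + 2) = up_dist n + (3 - 2 * golden_ratio)"
    by (rule up_dist_add[where z = 3])
      (use assms(2) dist_bounds[of n] golden_ratio_bounds in \<open>simp_all\<close>)
  \<comment> \<open>The cost is at most \<open>2 / scale 3\<close> = phi^-3, exactly the drop of the
    distance.\<close>
  have "real 2 / scale (i + 1) \<le> 2 * golden_ratio - 3"
    using divide_scale_le[of 3 "i + 1" 2] scale_values(3) i by simp
  then have "window i (n + 2) (up_dist (n + 2))"
    using f i by (intro window_increase) auto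
  then show ?thesis using i by (intro up_integersI[of _ i]) auto
qed

text \<open>At distance phi^-3 or more, 2 is a return. Below phi^-5, adding 3 raises the distance by
  phi^-4 and keeps it below phi^-3. In between, adding 5 lowers it by phi^-5 and leaves it below
  phi^-4.\<close>

lemma up_integers_return:
  assumes "n \<in> up_integers"
  shows "n + 2 \<in> up_integers \<or> n + 3 \<in> up_integers \<or> n + 5 \<in> up_integers"
proof -
  consider "up_dist n \<ge> 2 * golden_ratio - 3" | "up_dist n < 5 * golden_ratio - 8"
    | "5 * golden_ratio - 8 \<le> up_dist n" "up_dist n < 2 * golden_ratio - 3" by linarith
  then show ?thesis
  proof cases
    case 1
    then show ?thesis using up_integers_plus_2[OF assms] by simp
  next
    case 2
    have "up_dist (n + 3) = up_dist n + (5 - 3 * golden_ratio)"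
      by (rule up_dist_add[where z = 5])
        (use 2 dist_bounds[of n] golden_ratio_bounds in \<open>simp_all\<close>)
    then have "n + 3 \<in> up_integers" using 2 by (intro up_integers_of_small) auto
    then show ?thesis by simp
  next
    case 3
    have "up_dist (n + 5) = up_dist n + (8 - 5 * golden_ratio)"
      by (rule up_dist_add[where z = 8])
        (use 3 dist_bounds[of n] golden_ratio_bounds in \<open>simp_all\<close>)
    then have "n + 5 \<in> up_integers"
      using 3 golden_ratio_bounds by (intro up_integers_of_small) auto
    then show ?thesis by simp
  qed
qed

text \<open>For distance below phi^-3, going back from \<open>n + 4\<close> to \<open>n + 3\<close>
  lowers the distance by phi^-2 = \<open>1 / scale 2\<close>, which covers the cost for every even
  index.\<close>

lemma up_integers_4:
  assumes "n \<in> up_integers" "n + 4 \<in> up_integers"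
  shows "n + 2 \<in> up_integers \<or> n + 3 \<in> up_integers"
proof (cases "up_dist n \<ge> 2 * golden_ratio - 3")
  case True
  then show ?thesis using up_integers_plus_2[OF assms(1)] by simp
next
  case False
  have f: "up_dist (n + 4) = up_dist n + (7 - 4 * golden_ratio)"
    by (rule up_dist_add[where z = 7])
      (use False dist_bounds[of n] golden_ratio_bounds in \<open>simp_all\<close>)
  have f': "up_dist (n + 3) = up_dist n + (5 - 3 * golden_ratio)"
    by (rule up_dist_add[where z = 5])
      (use False dist_bounds[of n] golden_ratio_bounds in \<open>simp_all\<close>)
  obtain i where i: "even i" "i \<ge> 2" "window i (n + 4) (up_dist (n + 4))"
    using up_integers_windowE[OF assms(2)] by blast
  have "real 1 / scale i \<le> 2 - golden_ratio"
    using divide_scale_le[of 2 i 1] scale_values(2) i by simp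
  then have "window i (n + 3) (up_dist (n + 3))"
    using i f f' by (intro window_decrease[OF i(3), of _ 1]) auto
  then have "n + 3 \<in> up_integers" using i by (intro up_integersI[of _ i]) auto
  then show ?thesis ..
qed

text \<open>Below phi^-3 the rotation would wrap around and land at 1 - phi^-3 or beyond, too far
  for an up-integer.\<close>

lemma up_dist_plus_2:
  assumes "n + 2 \<in> up_integers"
  shows "up_dist n \<ge> 2 * golden_ratio - 3"
proof (rule ccontr)
  assume "\<not> ?thesis"
  then have "up_dist (n + 2) = up_dist n + (4 - 2 * golden_ratio)"
    using dist_bounds[of n] golden_ratio_bounds
    by (intro up_dist_add[where z = 4]) simp_all
  then show False using up_integers_dist_less[OF assms] dist_bounds[of n] by simp
qed

lemma up_integers_2_5:
  assumes "n \<in> up_integers" "n + 2 \<in> up_integers" "n \<ge> 9"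
  shows "n + 5 \<in> up_integers"
proof -
  obtain i where i: "even i" "i \<ge> 2" "0 < up_dist n" "window i n (up_dist n)"
    using up_integers_windowE[OF assms(1)] .
  \<comment> \<open>The bound 9 together with parity pushes the index to 4, so that adding 5 costs
    at most \<open>5 / scale 5\<close> = phi^-5, the drop of the distance.\<close>
  have "3 \<le> i" using window_index_ge i scale_less(2) assms(3) by blast
  then have "i \<ge> 4" using \<open>even i\<close> by (cases "i = 3") auto
  have f: "up_dist (n + 5) = up_dist n + (8 - 5 * golden_ratio)"
    by (rule up_dist_add[where z = 8])
      (use up_dist_plus_2[OF assms(2)] dist_bounds[of n] golden_ratio_bounds in \<open>simp_all\<close>)
  have "real 5 / scale (i + 1) \<le> 5 * golden_ratio - 8"
    using divide_scale_le[of 5 "i + 1" 5] scale_values(5) \<open>i \<ge> 4\<close> by simp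
  then have "window i (n + 5) (up_dist (n + 5))"
    using f i by (intro window_increase) auto
  then show ?thesis using i by (intro up_integersI[of _ i]) auto
qed

text \<open>Membership of \<open>n + 7\<close> keeps the distance at \<open>n + 5\<close> at least
  phi^-3. Adding 5 cannot have wrapped around, so the distance at \<open>n\<close> is larger still
  and 2 is already a return.\<close>

lemma up_integers_5_2:
  assumes "n \<in> up_integers" "n + 5 \<in> up_integers" "n + 7 \<in> up_integers"
  shows "n + 2 \<in> up_integers"
proof -
  have ge: "up_dist (n + 5) \<ge> 2 * golden_ratio - 3"
    using assms(3) by (intro up_dist_plus_2) (simp add: add.commute)
  have "up_dist n \<ge> 5 * golden_ratio - 8"
  proof (rule ccontr)
    assume "\<not> ?thesis"
    then have "up_dist (n + 5) = up_dist n + (9 - 5 * golden_ratio)"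
      using dist_bounds[of n] golden_ratio_bounds
      by (intro up_dist_add[where z = 9]) simp_all
    then show False
      using up_integers_dist_less[OF assms(2)] dist_bounds[of n] golden_ratio_bounds by simp
  qed
  then have "up_dist (n + 5) = up_dist n + (8 - 5 * golden_ratio)"
    using dist_bounds[of n] golden_ratio_bounds
    by (intro up_dist_add[where z = 8]) simp_all
  then show ?thesis
    using ge golden_ratio_bounds by (intro up_integers_plus_2[OF assms(1)]) linarith
qed

section \<open>Double gaps\<close>

text \<open>The list interval lets the simplifier unfold the condition for numerals.\<close>

definition consecutive :: "nat set \<Rightarrow> nat \<Rightarrow> nat \<Rightarrow> bool" where
  "consecutive S d e \<longleftrightarrow> d \<in> S \<and> e \<in> S \<and> d < e \<and> (\<forall>x\<in>set [Suc d..<e]. x \<notin> S)"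

lemma consecutive_enumerate:
  assumes "infinite S"
  shows "consecutive S (enumerate S k) (enumerate S (Suc k))"
proof -
  have "x \<notin> S" if "enumerate S k < x" "x < enumerate S (Suc k)" for x
    using that assms not_less_Least[of x "\<lambda>s. s \<in> S \<and> enumerate S k < s"]
    by (auto simp: enumerate_Suc'')
  then show ?thesis
    using assms unfolding consecutive_def by (auto simp: enumerate_in_set enumerate_step)
qed

lemma consecutive_unique:
  assumes "consecutive S d e" "consecutive S d f"
  shows "e = f"
  using assms unfolding consecutive_def by (cases e f rule: linorder_cases) auto

lemma consecutive_imp_enumerate:
  assumes "infinite S" "consecutive S d e" "consecutive S e f" "g = f - d"
  shows "g \<in> range (\<lambda>k. enumerate S (k + 2) - enumerate S k)"
proof -
  obtain k where k: "enumerate S k = d"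
    using enumerate_Ex[OF assms(1)] assms(2) unfolding consecutive_def by blast
  have "enumerate S (Suc k) = e"
    using consecutive_unique assms(2) consecutive_enumerate[OF assms(1)] k by metis
  moreover from this have "enumerate S (Suc (Suc k)) = f"
    using consecutive_unique assms(3) consecutive_enumerate[OF assms(1)] by metis
  ultimately show ?thesis using k assms(4) by (intro image_eqI[of _ _ k]) (simp_all del: enumerate.simps)
qed

lemma infinite_of_return:
  fixes S :: "nat set"
  assumes "S \<noteq> {}" "\<And>n. n \<in> S \<Longrightarrow> \<exists>h\<in>{1, 2, 3, 5}. n + h \<in> S"
  shows "infinite S"
proof
  assume "finite S"
  then obtain h where "h \<in> {1, 2, 3, 5}" "Max S + h \<in> S" using assms Max_in by meson
  then show False using Max_ge[OF \<open>finite S\<close>, of "Max S + h"] by auto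
qed

text \<open>Single gaps lie in {1, 2, 3, 5}. Among sums of two of them 9 does not occur and 7 occurs
  only as 2 + 5 or 5 + 2, so excluding these two patterns suffices.\<close>

lemma double_gaps:
  fixes S :: "nat set"
  assumes "infinite S"
    and return: "\<And>n. n \<in> S \<Longrightarrow> \<exists>h\<in>{1, 2, 3, 5}. n + h \<in> S"
    and no_4: "\<And>n. n \<in> S \<Longrightarrow> n + 4 \<in> S \<Longrightarrow> \<exists>h\<in>{1, 2, 3}. n + h \<in> S"
    and no_2_5: "\<And>n. n \<in> S \<Longrightarrow> n + 2 \<in> S \<Longrightarrow> \<exists>h\<in>{3, 4, 5}. n + h \<in> S"
    and no_5_2: "\<And>n. n \<in> S \<Longrightarrow> n + 5 \<in> S \<Longrightarrow> n + 7 \<in> S \<Longrightarrow> \<exists>h\<in>{1, 2, 3, 4}. n + h \<in> S"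
  shows "range (\<lambda>k. enumerate S (k + 2) - enumerate S k) \<subseteq> {2, 3, 4, 5, 6, 8, 10}"
proof (rule image_subsetI)
  fix k :: nat
  define d e f where "d = enumerate S k" and "e = enumerate S (Suc k)"
    and "f = enumerate S (Suc (Suc k))"
  have single: "y - x \<in> {1, 2, 3, 5}" if "consecutive S x y" for x y
  proof -
    have *: "x \<in> S" "y \<in> S" "x < y" "\<And>z. x < z \<Longrightarrow> z < y \<Longrightarrow> z \<notin> S"
      using that unfolding consecutive_def by auto
    obtain h where h: "h \<in> {1, 2, 3, 5}" "x + h \<in> S" using return *(1) by blast
    have "x < x + h" using h(1) by auto
    then have "y \<le> x + h" using *(4) h(2) by (meson not_le)
    moreover have "y - x \<noteq> 4"
    proof
      assume "y - x = 4"
      then have y: "y = x + 4" using *(3) by simp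
      then obtain h where "h \<in> {1, 2, 3}" "x + h \<in> S" using no_4 * by blast
      then show False using *(4)[of "x + h"] y by auto
    qed
    ultimately show ?thesis using h(1) *(3) by auto
  qed
  have de: "consecutive S d e" and ef: "consecutive S e f"
    unfolding d_def e_def f_def using consecutive_enumerate \<open>infinite S\<close> by blast+
  have mem: "d \<in> S" "e \<in> S" "f \<in> S" "d < e" "e < f"
    and gap: "\<And>z. d < z \<Longrightarrow> z < e \<Longrightarrow> z \<notin> S" "\<And>z. e < z \<Longrightarrow> z < f \<Longrightarrow> z \<notin> S"
    using de ef unfolding consecutive_def by auto
  have "\<not> (e - d = 2 \<and> f - e = 5)"
  proof
    assume "e - d = 2 \<and> f - e = 5"
    then have ef: "e = d + 2" "f = d + 7" using mem by auto
    then obtain h where "h \<in> {3, 4, 5}" "d + h \<in> S" using no_2_5 mem by blast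
    then show False using gap(2)[of "d + h"] ef by auto
  qed
  moreover have "\<not> (e - d = 5 \<and> f - e = 2)"
  proof
    assume "e - d = 5 \<and> f - e = 2"
    then have ef: "e = d + 5" "f = d + 7" using mem by auto
    then obtain h where "h \<in> {1, 2, 3, 4}" "d + h \<in> S" using no_5_2 mem by blast
    then show False using gap(1)[of "d + h"] ef by auto
  qed
  moreover have "f - d = (e - d) + (f - e)" using mem by simp
  ultimately have "f - d \<in> {2, 3, 4, 5, 6, 8, 10}"
    using single[OF de] single[OF ef] by auto
  then show "enumerate S (k + 2) - enumerate S k \<in> {2, 3, 4, 5, 6, 8, 10}"
    by (simp add: d_def f_def del: enumerate.simps)
qed

section \<open>Explicit samples and the exact sets of double gaps\<close>

lemma slow_rep_parity:
  assumes "slow_rep n i a b"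
  shows "if odd i then n \<in> down_integers \<and> n \<notin> up_integers
    else n \<in> up_integers \<and> n \<notin> down_integers"
  using assms down_integers_iff up_integers_iff not_down_and_up by (cases "odd i") (simp, blast)+

text \<open>The small integers that the return lemmas do not cover, and the first occurrences of the
  double gaps.\<close>

lemma sample_members:
  shows "\<forall>n\<in>{
     2, 5, 7, 9, 10, 12, 13, 15, 18, 23, 43, 44, 46, 47, 48, 49, 96, 99, 102, 746, 751, 756,
     1918, 1919, 1920, 1921, 1923, 1924, 1925, 1926}.
      n \<in> down_integers \<and> n \<notin> up_integers"
    and "\<forall>n\<in>{
     3, 4, 6, 8, 11, 14, 16, 17, 19, 20, 21, 22, 42, 45, 50, 97, 98, 100, 101, 747, 748, 749,
     750, 752, 753, 754, 755, 1917, 1922, 1927}.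
      n \<in> up_integers \<and> n \<notin> down_integers"
proof -
  \<comment> \<open>Entries are \<open>(n, i, a, b)\<close>. Each canonical representation is
    checked by arithmetic, and the parity of \<open>i\<close> settles membership.\<close>
  define T :: "(nat \<times> nat \<times> nat \<times> nat) list" where "T = [
     (2, 1, 1, 1), (3, 2, 1, 1), (4, 2, 2, 1), (5, 3, 1, 1), (6, 2, 2, 2), (7, 3, 2, 1),
     (8, 4, 1, 1), (9, 3, 3, 1), (10, 3, 2, 2), (11, 4, 2, 1), (12, 3, 3, 2), (13, 5, 1, 1),
     (14, 4, 3, 1), (15, 3, 3, 3), (16, 4, 2, 2), (17, 4, 4, 1), (18, 5, 2, 1), (19, 4, 3, 2),
     (20, 4, 5, 1), (21, 6, 1, 1), (22, 4, 4, 2), (23, 5, 3, 1), (42, 6, 2, 2), (43, 5, 7, 1),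
     (44, 5, 4, 3), (45, 6, 4, 1), (46, 5, 6, 2), (47, 7, 2, 1), (48, 5, 8, 1), (49, 5, 5, 3),
     (50, 6, 3, 2), (96, 5, 8, 7), (97, 8, 3, 1), (98, 6, 9, 2), (99, 7, 6, 1), (100, 6, 6, 4),
     (101, 6, 11, 1), (102, 7, 3, 3), (746, 9, 9, 8), (747, 8, 21, 9), (748, 8, 34, 1),
     (749, 10, 12, 1), (750, 8, 26, 6), (751, 9, 14, 5), (752, 8, 18, 11), (753, 8, 31, 3),
     (754, 12, 2, 2), (755, 8, 23, 8), (756, 9, 19, 2), (1917, 10, 30, 3), (1918, 9, 37, 12),
     (1919, 13, 5, 2), (1920, 9, 50, 4), (1921, 9, 29, 17), (1922, 10, 22, 8), (1923, 9, 42, 9),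
     (1924, 11, 20, 1), (1925, 9, 55, 1), (1926, 9, 34, 14), (1927, 10, 14, 13)]"
  have "\<forall>(n, i, a, b)\<in>set T. slow_rep n i a b"
    by (simp add: T_def slow_rep_def fib_values)
  then have "\<forall>(n, i, a, b)\<in>set T. if odd i then n \<in> down_integers \<and> n \<notin> up_integers
      else n \<in> up_integers \<and> n \<notin> down_integers"
    using slow_rep_parity by fast
  then show "\<forall>n\<in>{
     2, 5, 7, 9, 10, 12, 13, 15, 18, 23, 43, 44, 46, 47, 48, 49, 96, 99, 102, 746, 751, 756,
     1918, 1919, 1920, 1921, 1923, 1924, 1925, 1926}.
      n \<in> down_integers \<and> n \<notin> up_integers"
    and "\<forall>n\<in>{
     3, 4, 6, 8, 11, 14, 16, 17, 19, 20, 21, 22, 42, 45, 50, 97, 98, 100, 101, 747, 748, 749,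
     750, 752, 753, 754, 755, 1917, 1922, 1927}.
      n \<in> up_integers \<and> n \<notin> down_integers"
    by (simp_all add: T_def)
qed

lemmas samples = sample_members[simplified]

lemma down_integers_double_gaps:
  "infinite down_integers \<and>
    range (\<lambda>k. enumerate down_integers (k + 2) - enumerate down_integers k) = {2, 3, 4, 5, 6, 8, 10}"
    (is "_ \<and> range ?g = _")
proof -
  have ge_3: "n \<ge> 3" if "n \<in> down_integers" "n \<noteq> 2" for n
    using down_integers_ge_2[OF that(1)] that(2) by simp
  have return: "\<exists>h\<in>{1, 2, 3, 5}. n + h \<in> down_integers" if "n \<in> down_integers" for n
    using down_integers_return[OF that] ge_3[OF that] samples by (cases "n = 2") auto
  have inf: "infinite down_integers"
    by (rule infinite_of_return[OF _ return]) (use samples in auto)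
  have sub: "range ?g \<subseteq> {2, 3, 4, 5, 6, 8, 10}"
  proof (rule double_gaps[OF inf return])
    fix n assume n: "n \<in> down_integers"
    show "\<exists>h\<in>{1, 2, 3}. n + h \<in> down_integers" if "n + 4 \<in> down_integers"
      using down_integers_4[OF n that ge_3[OF n]] that samples by (cases "n = 2") auto
    show "\<exists>h\<in>{3, 4, 5}. n + h \<in> down_integers" if "n + 2 \<in> down_integers"
      using down_integers_2_5[OF n that] by simp
    show "\<exists>h\<in>{1, 2, 3, 4}. n + h \<in> down_integers"
      if "n + 5 \<in> down_integers" "n + 7 \<in> down_integers"
    proof (cases "n \<ge> 14")
      case True
      then show ?thesis using down_integers_5_2[OF n that(2)] by auto
    next
      case False
      then have "n \<in> {2, 3, 4, 5, 6, 7, 8, 9, 10, 11, 12, 13}"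
        using down_integers_ge_2[OF n] unfolding insert_iff empty_iff by presburger
      then show ?thesis
        using that n by (elim insertE emptyE) (simp_all add: samples)
    qed
  qed
  \<comment> \<open>Two adjacent gaps for each value: 1+1, 2+1, 2+2, 3+2, 3+3, 3+5 and 5+5.\<close>
  have cons:
    "consecutive down_integers 46 47" "consecutive down_integers 47 48"
    "consecutive down_integers 7 9" "consecutive down_integers 9 10"
    "consecutive down_integers 5 7" "consecutive down_integers 7 9"
    "consecutive down_integers 2 5" "consecutive down_integers 5 7"
    "consecutive down_integers 96 99" "consecutive down_integers 99 102"
    "consecutive down_integers 15 18" "consecutive down_integers 18 23"
    "consecutive down_integers 746 751" "consecutive down_integers 751 756"
    by (simp_all add: consecutive_def samples)
  have "2 \<in> range ?g" by (rule consecutive_imp_enumerate[OF inf cons(1,2)]) simp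
  moreover have "3 \<in> range ?g" by (rule consecutive_imp_enumerate[OF inf cons(3,4)]) simp
  moreover have "4 \<in> range ?g" by (rule consecutive_imp_enumerate[OF inf cons(5,6)]) simp
  moreover have "5 \<in> range ?g" by (rule consecutive_imp_enumerate[OF inf cons(7,8)]) simp
  moreover have "6 \<in> range ?g" by (rule consecutive_imp_enumerate[OF inf cons(9,10)]) simp
  moreover have "8 \<in> range ?g" by (rule consecutive_imp_enumerate[OF inf cons(11,12)]) simp
  moreover have "10 \<in> range ?g" by (rule consecutive_imp_enumerate[OF inf cons(13,14)]) simp
  ultimately show ?thesis using inf sub by (intro conjI equalityI) simp_all
qed

lemma up_integers_double_gaps:
  "infinite up_integers \<and>
    range (\<lambda>k. enumerate up_integers (k + 2) - enumerate up_integers k) = {2, 3, 4, 5, 6, 8, 10}"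
    (is "_ \<and> range ?g = _")
proof -
  have return: "\<exists>h\<in>{1, 2, 3, 5}. n + h \<in> up_integers" if "n \<in> up_integers" for n
    using up_integers_return[OF that] by auto
  have inf: "infinite up_integers"
    by (rule infinite_of_return[OF _ return]) (use samples in auto)
  have sub: "range ?g \<subseteq> {2, 3, 4, 5, 6, 8, 10}"
  proof (rule double_gaps[OF inf return])
    fix n assume n: "n \<in> up_integers"
    show "\<exists>h\<in>{1, 2, 3}. n + h \<in> up_integers" if "n + 4 \<in> up_integers"
      using up_integers_4[OF n that] by auto
    show "\<exists>h\<in>{3, 4, 5}. n + h \<in> up_integers" if "n + 2 \<in> up_integers"
    proof (cases "n \<ge> 9")
      case True
      then show ?thesis using up_integers_2_5[OF n that] by simp
    next
      case False
      then have "n \<in> {2, 3, 4, 5, 6, 7, 8}"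
        using up_integers_ge_2[OF n] unfolding insert_iff empty_iff by presburger
      then show ?thesis
        using that n by (elim insertE emptyE) (simp_all add: samples)
    qed
    show "\<exists>h\<in>{1, 2, 3, 4}. n + h \<in> up_integers"
      if "n + 5 \<in> up_integers" "n + 7 \<in> up_integers"
      using up_integers_5_2[OF n that] by auto
  qed
  \<comment> \<open>The adjacent gaps are 1+1, 1+2, 2+2, 2+3, 3+3, 3+5 and 5+5.\<close>
  have cons:
    "consecutive up_integers 19 20" "consecutive up_integers 20 21"
    "consecutive up_integers 3 4" "consecutive up_integers 4 6"
    "consecutive up_integers 4 6" "consecutive up_integers 6 8"
    "consecutive up_integers 6 8" "consecutive up_integers 8 11"
    "consecutive up_integers 8 11" "consecutive up_integers 11 14"
    "consecutive up_integers 42 45" "consecutive up_integers 45 50"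
    "consecutive up_integers 1917 1922" "consecutive up_integers 1922 1927"
    by (simp_all add: consecutive_def samples)
  have "2 \<in> range ?g" by (rule consecutive_imp_enumerate[OF inf cons(1,2)]) simp
  moreover have "3 \<in> range ?g" by (rule consecutive_imp_enumerate[OF inf cons(3,4)]) simp
  moreover have "4 \<in> range ?g" by (rule consecutive_imp_enumerate[OF inf cons(5,6)]) simp
  moreover have "5 \<in> range ?g" by (rule consecutive_imp_enumerate[OF inf cons(7,8)]) simp
  moreover have "6 \<in> range ?g" by (rule consecutive_imp_enumerate[OF inf cons(9,10)]) simp
  moreover have "8 \<in> range ?g" by (rule consecutive_imp_enumerate[OF inf cons(11,12)]) simp
  moreover have "10 \<in> range ?g" by (rule consecutive_imp_enumerate[OF inf cons(13,14)]) simp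
  ultimately show ?thesis using inf sub by (intro conjI equalityI) simp_all
qed

theorem theorem7:
  shows "infinite down_integers \<and> infinite up_integers \<and>
    range (\<lambda>k::nat. enumerate down_integers (k + 2) - enumerate down_integers k) = {2, 3, 4, 5, 6, 8, 10} \<and>
    range (\<lambda>k::nat. enumerate up_integers (k + 2) - enumerate up_integers k) = {2, 3, 4, 5, 6, 8, 10}"
  using down_integers_double_gaps up_integers_double_gaps by (elim conjE) (intro conjI; assumption)

end
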